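(* For every integer $n\ge 1$, $$\mathrm{pf}_n(213,312,321)=C_n+(n-1)(C_n-C_{n-1})=nC_n-(n-1)C_{n-1},$$ where $C_k=\frac{1}{k+1}\binom{2k}{k}$ is the $k$th Catalan number.
   Context: A Dyck path of semilength $n$ is a lattice path from $(0,0)$ to $(n,n)$ consisting of $n$ north steps $N=(0,1)$ and $n$ east steps $E=(1,0)$ that never goes below the line $y=x$. A parking function of size $n$ is a Dyck path of semilength $n$ whose $n$ north steps are labeled bijectively by $\{1,\dots,n\}$ so that whenever two north steps are consecutive in the path (one immediately following the other), the label of the later one is larger. For a parking function $p$ of size $n$, $\phi(p)$ is the permutation of $\{1,\dots,n\}$ (in one-line notation) obtained by reading the labels of the north steps in the order they occur along the path. A permutation $\pi$ of $\{1,\dots,n\}$ contains a permutation $\rho$ of $\{1,\dots,m\}$ if there are indices $1\le i_1<\cdots<i_m\le n$ such that $\pi_{i_a}\le\pi_{i_b}$ if and only if $\rho_a\le\rho_b$; otherwise $\pi$ avoids $\rho$. For permutations $\rho_1,\dots,\rho_r$, $\mathrm{pf}_n(\rho_1,\dots,\rho_r)$ denotes the number of parking functions $p$ of size $n$ such that $\phi(p)$ avoids each of $\rho_1,\dots,\rho_r$. *)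

theory Defs
  imports Complex_Main
begin

datatype step = N | E

text \<open>The lattice point reached after \<open>k\<close> steps from the origin is
  \<open>(count_list (take k w) E, count_list (take k w) N)\<close>.\<close>

definition dyck_path :: "nat \<Rightarrow> step list \<Rightarrow> bool" where
  "dyck_path n w \<longleftrightarrow>
     count_list w N = n \<and> count_list w E = n \<and>
     (\<forall>k \<le> length w. count_list (take k w) E \<le> count_list (take k w) N)"

text \<open>A path whose north steps carry labels is a list of labeled steps; the labels are numbers
  attached to the north steps only.\<close>

datatype labeled_step = North nat | East

fun unlabel :: "labeled_step \<Rightarrow> step" where
  "unlabel (North a) = N"
| "unlabel East = E"

fun \<phi> :: "labeled_step list \<Rightarrow> nat list" where
  "\<phi> [] = []"
| "\<phi> (North a # p) = a # \<phi> p"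
| "\<phi> (East # p) = \<phi> p"

definition parking_function :: "nat \<Rightarrow> labeled_step list \<Rightarrow> bool" where
  "parking_function n p \<longleftrightarrow>
     dyck_path n (map unlabel p) \<and>
     distinct (\<phi> p) \<and> set (\<phi> p) = {1..n} \<and>
     (\<forall>i a b. Suc i < length p \<and> p ! i = North a \<and> p ! Suc i = North b \<longrightarrow> a < b)"

text \<open>Permutations are lists of values (one-line notation), so positions are counted from 0;
  \<open>f\<close> gives the positions of the occurrence.\<close>

definition contains :: "nat list \<Rightarrow> nat list \<Rightarrow> bool" where
  "contains \<pi> \<rho> \<longleftrightarrow>
     (\<exists>f :: nat \<Rightarrow> nat. strict_mono_on {..<length \<rho>} f \<and> f ` {..<length \<rho>} \<subseteq> {..<length \<pi>} \<and>
        (\<forall>a < length \<rho>. \<forall>b < length \<rho>. \<pi> ! f a \<le> \<pi> ! f b \<longleftrightarrow> \<rho> ! a \<le> \<rho> ! b))"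

abbreviation avoids :: "nat list \<Rightarrow> nat list \<Rightarrow> bool" where
  "avoids \<pi> \<rho> \<equiv> \<not> contains \<pi> \<rho>"

definition pf :: "nat \<Rightarrow> nat list list \<Rightarrow> nat" where
  "pf n \<rho>s = card {p. parking_function n p \<and> (\<forall>\<rho> \<in> set \<rho>s. avoids (\<phi> p) \<rho>)}"

lemma length_phi: "length (\<phi> p) = count_list (map unlabel p) N"
  by (induction p rule: \<phi>.induct) auto

text \<open>The cardinality in \<open>pf\<close> is that of a finite set.\<close>

lemma finite_parking_functions: "finite {p. parking_function n p}"
proof -
  have len: "length w = count_list w N + count_list w E" for w
    by (induction w) (auto, metis step.exhaust)
  have labels: "set p \<subseteq> insert East (North ` set (\<phi> p))" for p
    by (induction p rule: \<phi>.induct) auto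
  have "{p. parking_function n p} \<subseteq>
      {p. set p \<subseteq> insert East (North ` {1..n}) \<and> length p = 2 * n}"
    using len[of "map unlabel _"] labels
    by (auto simp: parking_function_def dyck_path_def)
       (metis labels subsetD insertE)
  moreover have "finite \<dots>"
    by (rule finite_lists_length_eq) simp
  ultimately show ?thesis
    by (rule finite_subset)
qed

definition catalan :: "nat \<Rightarrow> real" where
  "catalan k = 1 / (real k + 1) * real ((2 * k) choose k)"

end

theory Submission
  imports Defs
begin

text \<open>In a permutation avoiding 213, 312 and 321 no entry other than the last can be smaller than
  an earlier one, so the permutation is increasing up to its last entry \<open>k\<close>, which determines it.
  For \<open>k = n\<close> it is the identity and every Dyck path can carry it. For \<open>k < n\<close> its only descent is
  at the end, so the path must not have its last two north steps adjacent; deleting one of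
  these two steps and the final east step shows that \<open>C\<^sub>n\<^sub>-\<^sub>1\<close> Dyck paths are excluded.\<close>

section \<open>Ballot paths\<close>

text \<open>The prefix condition of \<open>dyck_path\<close> without equal step counts, so that it
  passes to prefixes and supports induction on the last step.\<close>

definition ballot :: "step list \<Rightarrow> bool" where
  "ballot w \<longleftrightarrow> (\<forall>k \<le> length w. count_list (take k w) E \<le> count_list (take k w) N)"

definition ballot_paths :: "nat \<Rightarrow> nat \<Rightarrow> step list set" where
  "ballot_paths a b = {w. ballot w \<and> count_list w N = a \<and> count_list w E = b}"

lemma dyck_path_iff: "dyck_path n w \<longleftrightarrow> w \<in> ballot_paths n n"
  by (auto simp: dyck_path_def ballot_paths_def ballot_def)

lemma ballot_Nil [simp]: "ballot []"
  by (simp add: ballot_def)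

lemma ballot_snoc:
  "ballot (w @ [x]) \<longleftrightarrow> ballot w \<and> count_list (w @ [x]) E \<le> count_list (w @ [x]) N"
proof
  assume l: "ballot (w @ [x])"
  have "count_list (take k w) E \<le> count_list (take k w) N" if "k \<le> length w" for k
    using l[unfolded ballot_def, rule_format, of k] that by simp
  moreover have "count_list (w @ [x]) E \<le> count_list (w @ [x]) N"
    using l[unfolded ballot_def, rule_format, of "Suc (length w)"] by simp
  ultimately show "ballot w \<and> count_list (w @ [x]) E \<le> count_list (w @ [x]) N"
    by (simp add: ballot_def)
next
  assume "ballot w \<and> count_list (w @ [x]) E \<le> count_list (w @ [x]) N"
  then show "ballot (w @ [x])"
    by (auto simp: ballot_def le_Suc_eq)
qed

lemma ballot_count: "ballot w \<Longrightarrow> count_list w E \<le> count_list w N"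
  by (auto simp: ballot_def dest: spec[of _ "length w"])

lemma ballot_appendD: "ballot (u @ v) \<Longrightarrow> ballot u"
proof (induction v rule: rev_induct)
  case (snoc x v)
  then show ?case
    using ballot_snoc[of "u @ v" x] by simp
qed simp

lemma ballot_snoc_N: "ballot (w @ [N]) \<longleftrightarrow> ballot w"
  using ballot_count[of w] by (auto simp: ballot_snoc)

text \<open>Along \<open>v\<close> only east steps occur, so the excess of north over east steps is
  smallest at the end, where the second assumption controls it.\<close>

lemma ballot_append_no_N:
  assumes "N \<notin> set v" "count_list (u @ v) E \<le> count_list (u @ v) N"
  shows "ballot (u @ v) \<longleftrightarrow> ballot u"
  using assms
proof (induction v rule: rev_induct)
  case (snoc x v)
  have x: "x = E"
    using snoc.prems(1) by (cases x) auto
  have "ballot (u @ v) \<longleftrightarrow> ballot u"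
    using snoc x by auto
  then show ?case
    using snoc.prems(2) ballot_snoc[of "u @ v" x] by auto
qed simp

section \<open>Counting ballot paths by their endpoint\<close>

lemma ballot_paths_empty: "a < b \<Longrightarrow> ballot_paths a b = {}"
  using ballot_count by (fastforce simp: ballot_paths_def)

lemma ballot_paths_0: "ballot_paths a 0 = {replicate a N}"
proof -
  have "w = replicate a N" if "count_list w E = 0" "count_list w N = a" for w
    using that
  proof (induction w arbitrary: a)
    case (Cons x w)
    then show ?case by (cases x) auto
  qed simp
  moreover have "ballot (replicate a N) \<and> count_list (replicate a N) N = a
      \<and> count_list (replicate a N) E = 0"
  proof (induction a)
    case (Suc a)
    then show ?case
      using ballot_snoc_N[of "replicate a N"] by (simp add: replicate_append_same)
  qed simp
  ultimately show ?thesis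
    by (auto simp: ballot_paths_def)
qed

text \<open>Split by the last step. Since \<open>b \<le> a\<close>, the endpoint is admissible, so
  either step may be appended to a ballot path.\<close>

lemma ballot_paths_Suc:
  assumes "b \<le> a"
  shows "ballot_paths (Suc a) (Suc b) =
    (\<lambda>w. w @ [N]) ` ballot_paths a (Suc b) \<union> (\<lambda>w. w @ [E]) ` ballot_paths (Suc a) b" (is "?L = ?R")
proof (intro set_eqI iffI)
  fix w assume w: "w \<in> ?L"
  then have "w \<noteq> []" by (auto simp: ballot_paths_def)
  then obtain v x where v: "w = v @ [x]" by (metis rev_exhaust)
  show "w \<in> ?R"
    using w unfolding v by (cases x) (auto simp: ballot_paths_def ballot_snoc)
next
  fix w assume "w \<in> ?R"
  then show "w \<in> ?L"
    using assms by (auto simp: ballot_paths_def ballot_snoc)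
qed

text \<open>These are the ballot numbers: the recursion on the last step agrees with Pascal's rule
  for both binomials. The range reaches \<open>b = Suc a\<close> because removing a north step from
  a path ending on the diagonal asks for that value. The conditional stands for the binomial with
  lower index -1, as \<open>b - 1\<close> is truncated.\<close>

lemma card_ballot_paths:
  "b \<le> Suc a \<Longrightarrow> finite (ballot_paths a b) \<and>
     real (card (ballot_paths a b)) =
       real ((a + b) choose b) - (if b = 0 then 0 else real ((a + b) choose (b - 1)))"
proof (induction "a + b" arbitrary: a b rule: less_induct)
  case less
  consider "b = 0" | "b = Suc a" | a' b' where "a = Suc a'" "b = Suc b'" "b' \<le> a'"
    using less.prems by (cases a; cases b) (auto simp: le_Suc_eq)
  then show ?case
  proof cases
    case 1
    then show ?thesis by (simp add: ballot_paths_0)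
  next
    case 2
    \<comment> \<open>There are no paths to such an endpoint, and the formula subtracts the two
      equal middle binomials of row \<open>2 * a + 1\<close>.\<close>
    then show ?thesis
      using binomial_symmetric[of a "Suc (2 * a)"]
      by (simp add: ballot_paths_empty mult_2)
  next
    case 3
    have N: "finite (ballot_paths a' b)" "real (card (ballot_paths a' b)) =
        real ((a' + b) choose b) - real ((a' + b) choose b')"
      using less.hyps[of a' b] 3 by auto
    have E: "finite (ballot_paths a b')" "real (card (ballot_paths a b')) =
        real ((a + b') choose b') - (if b' = 0 then 0 else real ((a + b') choose (b' - 1)))"
      using less.hyps[of a b'] 3 by auto
    have eq: "ballot_paths a b =
        (\<lambda>w. w @ [N]) ` ballot_paths a' b \<union> (\<lambda>w. w @ [E]) ` ballot_paths a b'"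
      using ballot_paths_Suc[of b' a'] 3 by simp
    have card: "card (ballot_paths a b) = card (ballot_paths a' b) + card (ballot_paths a b')"
      unfolding eq using N(1) E(1)
      by (subst card_Un_disjoint) (auto simp: card_image inj_on_def)
    have "finite (ballot_paths a b)"
      unfolding eq using N(1) E(1) by simp
    then show ?thesis
      unfolding card of_nat_add N(2) E(2) using 3
      by (cases b') auto
  qed
qed

text \<open>The left neighbour of the middle binomial is n/(n+1) times the middle one, which leaves
  1/(n+1) of it as the difference.\<close>

lemma catalan_eq_diff:
  "catalan n = real ((2 * n) choose n) - (if n = 0 then 0 else real ((2 * n) choose (n - 1)))"
proof (cases n)
  case (Suc m)
  have "Suc m * ((2 * n) choose Suc m) = (2 * n - m) * ((2 * n) choose m)"
    using binomial_absorb_comp[of "2 * n" m] binomial_absorption[of m "2 * n"]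
    by simp
  then have "Suc m * ((2 * n) choose n) = (m + 2) * ((2 * n) choose m)"
    by (simp add: Suc)
  then have "real (Suc m) * real ((2 * n) choose n) = real (m + 2) * real ((2 * n) choose m)"
    by (metis of_nat_mult)
  then have "real ((2 * n) choose m) = real (Suc m) * real ((2 * n) choose n) / real (m + 2)"
    by (simp add: field_simps)
  then show ?thesis
    by (simp add: catalan_def Suc field_simps del: binomial_Suc_Suc)
qed (simp add: catalan_def)

lemma finite_dyck_paths: "finite {w. dyck_path n w}"
  using card_ballot_paths[of n n] by (simp add: dyck_path_iff)

lemma card_dyck_paths: "real (card {w. dyck_path n w}) = catalan n"
  using card_ballot_paths[of n n] by (simp add: dyck_path_iff catalan_eq_diff mult_2)

section \<open>Paths whose last two north steps are adjacent\<close>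

text \<open>The displayed steps are the last two north steps; east steps may follow them.\<close>

definition ends_NN :: "step list \<Rightarrow> bool" where
  "ends_NN w \<longleftrightarrow> (\<exists>u v. w = u @ N # N # v \<and> N \<notin> set v)"

text \<open>The displayed \<open>x\<close> is the last one in the word, so its position is
  determined. This gives injectivity for words cut at their last north step.\<close>

lemma append_Cons_last_eq:
  assumes "u @ x # v = u' @ x # v'" "x \<notin> set v" "x \<notin> set v'"
  shows "u = u' \<and> v = v'"
  using assms
proof (induction u arbitrary: u')
  case Nil
  then show ?case by (cases u') auto
next
  case (Cons y u)
  then show ?case by (cases u') auto
qed

text \<open>Added north steps never violate the prefix condition, and a final run of east steps is
  constrained only by the counts at its end. For either word the condition thus reduces to
  \<open>ballot u\<close>.\<close>

lemma dyck_path_double_last_N: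
  assumes "N \<notin> set v"
  shows "dyck_path (Suc n) (u @ N # N # v @ [E]) \<longleftrightarrow> dyck_path n (u @ N # v)"
proof -
  have "ballot (u @ N # v) \<longleftrightarrow> ballot u"
    if "count_list (u @ N # v) E = count_list (u @ N # v) N"
    using ballot_append_no_N[of v "u @ [N]"] assms that by (simp add: ballot_snoc_N)
  moreover have "ballot (u @ N # N # v @ [E]) \<longleftrightarrow> ballot u"
    if "count_list (u @ N # v) E = count_list (u @ N # v) N"
    using ballot_append_no_N[of "v @ [E]" "(u @ [N]) @ [N]"] assms that
    by (simp add: ballot_snoc_N del: append_assoc) simp
  ultimately show ?thesis
    by (auto simp: dyck_path_iff ballot_paths_def)
qed

text \<open>Cutting at the last north step parametrises both sets by the same pairs:
  \<open>u @ N # v\<close> on one side, \<open>u @ N # N # v @ [E]\<close> on the other. The bound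
  on \<open>n\<close> supplies a north step at which to cut.\<close>

lemma card_dyck_paths_ends_NN:
  assumes "n \<ge> 1"
  shows "card {w. dyck_path (Suc n) w \<and> ends_NN w} = card {w. dyck_path n w}"
proof -
  define T where "T = {(u, v). N \<notin> set v \<and> dyck_path n (u @ N # v)}"
  have "{w. dyck_path n w} = (\<lambda>(u, v). u @ N # v) ` T"
  proof (intro set_eqI iffI)
    fix w assume w: "w \<in> {w. dyck_path n w}"
    then have "N \<in> set w"
      using assms by (metis count_notin dyck_path_def mem_Collect_eq not_one_le_zero)
    then obtain u v where "w = u @ N # v" "N \<notin> set v"
      by (metis split_list_last)
    with w show "w \<in> (\<lambda>(u, v). u @ N # v) ` T"
      by (auto simp: T_def)
  qed (auto simp: T_def)
  moreover have "inj_on (\<lambda>(u, v). u @ N # v) T"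
    unfolding T_def inj_on_def by clarify (metis append_Cons_last_eq)
  moreover have "{w. dyck_path (Suc n) w \<and> ends_NN w} = (\<lambda>(u, v). u @ N # N # v @ [E]) ` T"
  proof (intro set_eqI iffI)
    fix w assume "w \<in> {w. dyck_path (Suc n) w \<and> ends_NN w}"
    then obtain u v where w: "dyck_path (Suc n) w" "w = u @ N # N # v" "N \<notin> set v"
      by (auto simp: ends_NN_def)
    \<comment> \<open>There is a final east step to delete: otherwise \<open>u\<close> would have
      two more east steps than north steps.\<close>
    have "v \<noteq> []"
    proof
      assume "v = []"
      then have "ballot u" "count_list u E = count_list u N + 2"
        using w by (auto simp: dyck_path_iff ballot_paths_def dest: ballot_appendD)
      then show False
        using ballot_count[of u] by simp
    qed
    then obtain v' x where v: "v = v' @ [x]"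
      by (metis rev_exhaust)
    moreover have "x = E"
      using w(3) v by (cases x) auto
    ultimately show "w \<in> (\<lambda>(u, v). u @ N # N # v @ [E]) ` T"
      using w dyck_path_double_last_N[of v' n u] by (auto simp: T_def)
  next
    fix w assume "w \<in> (\<lambda>(u, v). u @ N # N # v @ [E]) ` T"
    then obtain u v where "w = u @ N # N # v @ [E]" "N \<notin> set v" "dyck_path n (u @ N # v)"
      by (auto simp: T_def)
    moreover from this have "ends_NN w"
      unfolding ends_NN_def by (intro exI[of _ u] exI[of _ "v @ [E]"]) simp
    ultimately show "w \<in> {w. dyck_path (Suc n) w \<and> ends_NN w}"
      by (simp add: dyck_path_double_last_N)
  qed
  moreover have "inj_on (\<lambda>(u, v). u @ N # N # v @ [E]) T"
  proof (rule inj_onI, clarify)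
    fix u v u' v'
    assume "(u, v) \<in> T" "(u', v') \<in> T" "u @ N # N # v @ [E] = u' @ N # N # v' @ [E]"
    \<comment> \<open>The second displayed \<open>N\<close> is the last north step, so the cut comes
      after \<open>u @ [N]\<close>.\<close>
    then show "u = u' \<and> v = v'"
      using append_Cons_last_eq[of "u @ [N]" N "v @ [E]" "u' @ [N]" "v' @ [E]"]
      by (auto simp: T_def)
  qed
  ultimately show ?thesis
    by (simp add: card_image)
qed

section \<open>Labelings of a path\<close>

lemma phi_append: "\<phi> (p @ q) = \<phi> p @ \<phi> q"
  by (induction p rule: \<phi>.induct) auto

lemma phi_eq_Nil_iff: "\<phi> p = [] \<longleftrightarrow> N \<notin> set (map unlabel p)"
  by (induction p rule: \<phi>.induct) auto

lemma unlabel_eq_N_iff: "unlabel s = N \<longleftrightarrow> (\<exists>a. s = North a)"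
  by (cases s) auto

lemma labeled_path_eqI:
  "map unlabel p = map unlabel q \<Longrightarrow> \<phi> p = \<phi> q \<Longrightarrow> p = q"
proof (induction p arbitrary: q)
  case (Cons s p)
  then obtain t q' where "q = t # q'" by (cases q) auto
  with Cons show ?case by (cases s; cases t) auto
qed simp

lemma labeled_path_exists:
  "count_list w N = length \<pi> \<Longrightarrow> \<exists>p. map unlabel p = w \<and> \<phi> p = \<pi>"
proof (induction w arbitrary: \<pi>)
  case (Cons s w)
  show ?case
  proof (cases s)
    case N
    then obtain a \<pi>' where \<pi>: "\<pi> = a # \<pi>'" "count_list w N = length \<pi>'"
      using Cons.prems by (cases \<pi>) auto
    obtain p where "map unlabel p = w \<and> \<phi> p = \<pi>'"
      using Cons.IH[OF \<pi>(2)] by blast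
    then show ?thesis
      using N \<pi> by (intro exI[of _ "North a # p"]) simp
  next
    case E
    then obtain p where "map unlabel p = w \<and> \<phi> p = \<pi>"
      using Cons by auto
    then show ?thesis
      using E by (intro exI[of _ "East # p"]) simp
  qed
qed simp

text \<open>A labeled path amounts to a path and a label sequence of matching length, so a fixed
  sequence leaves only the choice of path.\<close>

lemma card_labeled_paths:
  assumes "\<And>w. Q w \<Longrightarrow> count_list w N = length \<pi>"
  shows "card {p. Q (map unlabel p) \<and> \<phi> p = \<pi>} = card {w. Q w}"
proof (rule bij_betw_same_card[of "map unlabel"])
  show "bij_betw (map unlabel) {p. Q (map unlabel p) \<and> \<phi> p = \<pi>} {w. Q w}"
    unfolding bij_betw_def
  proof
    show "inj_on (map unlabel) {p. Q (map unlabel p) \<and> \<phi> p = \<pi>}"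
      by (auto intro!: inj_onI labeled_path_eqI)
    show "map unlabel ` {p. Q (map unlabel p) \<and> \<phi> p = \<pi>} = {w. Q w}"
      using labeled_path_exists assms by (fastforce simp: image_iff)
  qed
qed

text \<open>The index condition of \<open>parking_function\<close> restated through factorisations
  of the list, to which \<open>phi_append\<close> applies.\<close>

definition consecutive_increasing :: "labeled_step list \<Rightarrow> bool" where
  "consecutive_increasing p \<longleftrightarrow> (\<forall>u a b v. p = u @ North a # North b # v \<longrightarrow> a < b)"

lemma parking_function_iff:
  "parking_function n p \<longleftrightarrow> dyck_path n (map unlabel p) \<and>
     distinct (\<phi> p) \<and> set (\<phi> p) = {1..n} \<and> consecutive_increasing p"
proof -
  have "(\<forall>i a b. Suc i < length p \<and> p ! i = North a \<and> p ! Suc i = North b \<longrightarrow> a < b)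
      \<longleftrightarrow> consecutive_increasing p"
    unfolding consecutive_increasing_def
  proof (intro iffI allI impI)
    fix u a b v
    assume *: "\<forall>i a b. Suc i < length p \<and> p ! i = North a \<and> p ! Suc i = North b \<longrightarrow> a < b"
      and p: "p = u @ North a # North b # v"
    have "Suc (length u) < length p" "p ! length u = North a" "p ! Suc (length u) = North b"
      by (simp_all add: p nth_append)
    with * show "a < b" by blast
  next
    fix i a b
    assume *: "\<forall>u a b v. p = u @ North a # North b # v \<longrightarrow> a < b"
      and i: "Suc i < length p \<and> p ! i = North a \<and> p ! Suc i = North b"
    have "p = take i p @ p ! i # p ! Suc i # drop (Suc (Suc i)) p"
      using i by (metis Cons_nth_drop_Suc Suc_lessD append_take_drop_id)
    with * i show "a < b" by metis
  qed
  then show ?thesis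
    by (simp add: parking_function_def)
qed

text \<open>Labels of adjacent north steps are also adjacent in \<open>\<phi> p\<close>.\<close>

lemma consecutive_increasing_sorted:
  assumes "sorted_wrt (<) (\<phi> p)"
  shows "consecutive_increasing p"
  using assms by (auto simp: consecutive_increasing_def phi_append sorted_wrt_append)

text \<open>The only descent of \<open>\<phi> p\<close> is from \<open>last xs\<close> to
  \<open>k\<close>, the labels of the last two north steps, so the condition fails exactly when
  these steps are adjacent.\<close>

lemma consecutive_increasing_last_descent:
  assumes phi: "\<phi> p = xs @ [k]" and sorted: "sorted_wrt (<) xs"
    and descent: "xs \<noteq> []" "k < last xs"
  shows "consecutive_increasing p \<longleftrightarrow> \<not> ends_NN (map unlabel p)"
proof
  assume inc: "consecutive_increasing p"
  show "\<not> ends_NN (map unlabel p)"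
  proof
    assume "ends_NN (map unlabel p)"
    then obtain u a b v where p: "p = u @ North a # North b # v" and "N \<notin> set (map unlabel v)"
      by (auto simp: ends_NN_def map_eq_append_conv map_eq_Cons_conv unlabel_eq_N_iff
          dest!: sym[of N])
    then have "xs @ [k] = (\<phi> u @ [a]) @ [b]"
      using phi by (simp add: phi_append phi_eq_Nil_iff[THEN iffD2])
    then have "k = b" "last xs = a"
      by auto
    moreover have "a < b"
      using inc p unfolding consecutive_increasing_def by blast
    ultimately show False
      using descent by simp
  qed
next
  assume not: "\<not> ends_NN (map unlabel p)"
  show "consecutive_increasing p"
    unfolding consecutive_increasing_def
  proof (intro allI impI)
    fix u a b v assume p: "p = u @ North a # North b # v"
    have "map unlabel p = map unlabel u @ N # N # map unlabel v"
      by (simp add: p)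
    \<comment> \<open>Some label follows \<open>b\<close>, so \<open>a\<close> and \<open>b\<close>
      both lie in the increasing part \<open>xs\<close>.\<close>
    then have "\<phi> v \<noteq> []"
      using not unfolding ends_NN_def phi_eq_Nil_iff by blast
    then obtain ys y where ys: "\<phi> v = ys @ [y]"
      by (metis rev_exhaust)
    then have "xs = \<phi> u @ a # b # ys"
      using phi by (simp add: p phi_append)
    then show "a < b"
      using sorted by (simp add: sorted_wrt_append)
  qed
qed

section \<open>Permutations avoiding 213, 312 and 321\<close>

text \<open>Three explicit positions replace the embedding; comparisons of a position with itself
  are trivial, which leaves six.\<close>

lemma contains_length_3:
  "contains \<pi> [x, y, z] \<longleftrightarrow>
     (\<exists>i j k. i < j \<and> j < k \<and> k < length \<pi> \<and>
        (\<pi> ! i \<le> \<pi> ! j \<longleftrightarrow> x \<le> y) \<and> (\<pi> ! j \<le> \<pi> ! i \<longleftrightarrow> y \<le> x) \<and>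
        (\<pi> ! i \<le> \<pi> ! k \<longleftrightarrow> x \<le> z) \<and> (\<pi> ! k \<le> \<pi> ! i \<longleftrightarrow> z \<le> x) \<and>
        (\<pi> ! j \<le> \<pi> ! k \<longleftrightarrow> y \<le> z) \<and> (\<pi> ! k \<le> \<pi> ! j \<longleftrightarrow> z \<le> y))" (is "?L \<longleftrightarrow> ?R")
proof -
  have three: "{..<length [x, y, z]} = {0, 1, 2}"
    by auto
  have all: "(\<forall>a < length [x, y, z]. P a) \<longleftrightarrow> P 0 \<and> P 1 \<and> P 2" for P
    by (auto simp: less_Suc_eq numeral_2_eq_2)
  show ?thesis
  proof
    assume ?L
    then obtain f where f: "strict_mono_on {0, 1, 2::nat} f" "f ` {0, 1, 2} \<subseteq> {..<length \<pi>}"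
      and order: "\<forall>a < length [x, y, z]. \<forall>b < length [x, y, z].
         \<pi> ! f a \<le> \<pi> ! f b \<longleftrightarrow> [x, y, z] ! a \<le> [x, y, z] ! b"
      unfolding contains_def three by blast
    have "f 0 < f 1" "f 1 < f 2" "f 2 < length \<pi>"
      using f by (auto simp: strict_mono_on_def)
    with order show ?R
      unfolding all by (intro exI[of _ "f 0"] exI[of _ "f 1"] exI[of _ "f 2"]) simp
  next
    assume ?R
    then obtain i j k where *: "i < j \<and> j < k \<and> k < length \<pi> \<and>
        (\<pi> ! i \<le> \<pi> ! j \<longleftrightarrow> x \<le> y) \<and> (\<pi> ! j \<le> \<pi> ! i \<longleftrightarrow> y \<le> x) \<and>
        (\<pi> ! i \<le> \<pi> ! k \<longleftrightarrow> x \<le> z) \<and> (\<pi> ! k \<le> \<pi> ! i \<longleftrightarrow> z \<le> x) \<and>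
        (\<pi> ! j \<le> \<pi> ! k \<longleftrightarrow> y \<le> z) \<and> (\<pi> ! k \<le> \<pi> ! j \<longleftrightarrow> z \<le> y)"
      by blast
    show ?L
      unfolding contains_def three all using *
      by (intro exI[of _ "(!) [i, j, k]"]) (auto simp: strict_mono_on_def)
  qed
qed

text \<open>The three patterns are exactly those of length 3 whose first entry exceeds the second.
  An inversion before the last entry forms one of them together with that entry, whose relative size
  decides which; conversely, each occurrence has an inversion before its third position.\<close>

lemma avoids_iff_sorted_butlast:
  assumes "distinct \<pi>"
  shows "(\<forall>\<rho> \<in> set [[2,1,3], [3,1,2], [3,2,1]]. avoids \<pi> \<rho>) \<longleftrightarrow> sorted_wrt (<) (butlast \<pi>)"
proof
  assume avoid: "\<forall>\<rho> \<in> set [[2,1,3], [3,1,2], [3,2,1]]. avoids \<pi> \<rho>"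
  show "sorted_wrt (<) (butlast \<pi>)"
    unfolding sorted_wrt_iff_nth_less
  proof (intro allI impI, rule ccontr)
    fix i j
    assume ij: "i < j" "j < length (butlast \<pi>)" and "\<not> butlast \<pi> ! i < butlast \<pi> ! j"
    \<comment> \<open>The last position completes the inversion at \<open>i\<close> and
      \<open>j\<close> to an occurrence.\<close>
    define k where "k = length \<pi> - 1"
    have k: "j < k" "k < length \<pi>"
      using ij by (auto simp: k_def)
    have "\<not> \<pi> ! i < \<pi> ! j"
      using \<open>\<not> butlast \<pi> ! i < butlast \<pi> ! j\<close> ij by (simp add: nth_butlast)
    moreover have "\<pi> ! i \<noteq> \<pi> ! j" "\<pi> ! i \<noteq> \<pi> ! k" "\<pi> ! j \<noteq> \<pi> ! k"
      using assms ij(1) k by (simp_all add: nth_eq_iff_index_eq)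
    ultimately consider "\<pi> ! j < \<pi> ! i" "\<pi> ! i < \<pi> ! k" | "\<pi> ! j < \<pi> ! k" "\<pi> ! k < \<pi> ! i"
      | "\<pi> ! k < \<pi> ! j" "\<pi> ! j < \<pi> ! i"
      by linarith
    then have "contains \<pi> [2,1,3] \<or> contains \<pi> [3,1,2] \<or> contains \<pi> [3,2,1]"
    proof cases
      case 1
      then have "contains \<pi> [2,1,3]"
        unfolding contains_length_3 using ij(1) k
        by (intro exI[of _ i] exI[of _ j] exI[of _ k]) auto
      then show ?thesis by blast
    next
      case 2
      then have "contains \<pi> [3,1,2]"
        unfolding contains_length_3 using ij(1) k
        by (intro exI[of _ i] exI[of _ j] exI[of _ k]) auto
      then show ?thesis by blast
    next
      case 3
      then have "contains \<pi> [3,2,1]"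
        unfolding contains_length_3 using ij(1) k
        by (intro exI[of _ i] exI[of _ j] exI[of _ k]) auto
      then show ?thesis by blast
    qed
    with avoid show False by simp
  qed
next
  assume sorted: "sorted_wrt (<) (butlast \<pi>)"
  have "\<pi> ! i < \<pi> ! j" if "i < j" "j < k" "k < length \<pi>" for i j k
    using sorted_wrt_nth_less[OF sorted that(1)] that by (simp add: nth_butlast)
  then have "\<not> \<pi> ! j \<le> \<pi> ! i" if "i < j" "j < k" "k < length \<pi>" for i j k
    using that by (meson leD)
  then have "avoids \<pi> [2,1,3]" "avoids \<pi> [3,1,2]" "avoids \<pi> [3,2,1]"
    unfolding contains_length_3 by (auto dest: le_trans)
  then show "\<forall>\<rho> \<in> set [[2,1,3], [3,1,2], [3,2,1]]. avoids \<pi> \<rho>"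
    by simp
qed

definition sorted_except_last :: "nat \<Rightarrow> nat \<Rightarrow> nat list" where
  "sorted_except_last n k = sorted_list_of_set ({1..n} - {k}) @ [k]"

text \<open>A strictly increasing list is determined by its set, so the last entry fixes the
  permutation.\<close>

lemma permutation_sorted_butlast_iff:
  assumes "n \<ge> 1"
  shows "distinct \<pi> \<and> set \<pi> = {1..n} \<and> sorted_wrt (<) (butlast \<pi>) \<longleftrightarrow>
    (\<exists>k \<in> {1..n}. \<pi> = sorted_except_last n k)"
proof
  assume *: "distinct \<pi> \<and> set \<pi> = {1..n} \<and> sorted_wrt (<) (butlast \<pi>)"
  then have "\<pi> \<noteq> []" using assms by auto
  then obtain xs k where \<pi>: "\<pi> = xs @ [k]"
    by (metis rev_exhaust)
  with * have "set xs = {1..n} - {k}" "sorted_wrt (<) xs" "k \<in> {1..n}"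
    by auto
  then have "xs = sorted_list_of_set ({1..n} - {k})"
    by (metis strict_sorted_equal strict_sorted_list_of_set set_sorted_list_of_set finite_Diff
        finite_atLeastAtMost)
  then show "\<exists>k \<in> {1..n}. \<pi> = sorted_except_last n k"
    using \<pi> \<open>k \<in> {1..n}\<close> by (auto simp: sorted_except_last_def)
qed (auto simp: sorted_except_last_def)

section \<open>Counting\<close>

lemma card_parking_functions_fibre:
  assumes k: "k \<in> {1..n}"
  shows "real (card {p. parking_function n p \<and> \<phi> p = sorted_except_last n k}) =
    (if k = n then catalan n else catalan n - catalan (n - 1))"
proof -
  let ?\<pi> = "sorted_except_last n k" and ?xs = "sorted_list_of_set ({1..n} - {k})"
  have \<pi>: "distinct ?\<pi>" "set ?\<pi> = {1..n}"
    using permutation_sorted_butlast_iff[of n ?\<pi>] k by auto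
  then have len: "length ?\<pi> = n"
    using distinct_card by fastforce
  show ?thesis
  proof (cases "k = n")
    case True
    then have "sorted_wrt (<) ?\<pi>"
      by (auto simp: sorted_except_last_def sorted_wrt_append)
    then have "{p. parking_function n p \<and> \<phi> p = ?\<pi>} =
        {p. dyck_path n (map unlabel p) \<and> \<phi> p = ?\<pi>}"
      using \<pi> consecutive_increasing_sorted by (auto simp: parking_function_iff)
    also have "card \<dots> = card {w. dyck_path n w}"
      by (rule card_labeled_paths) (simp add: len dyck_path_def)
    finally show ?thesis
      using True by (simp add: card_dyck_paths)
  next
    case False
    then have n: "k < n" using k by simp
    then have mem: "n \<in> set ?xs" by auto
    then have "?xs \<noteq> []" by (metis empty_iff empty_set)
    then obtain ys y where ys: "?xs = ys @ [y]"
      by (metis rev_exhaust)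
    moreover have "sorted_wrt (<) ?xs"
      by simp
    \<comment> \<open>The largest value ends the increasing part, so \<open>k < n\<close> creates a
      descent at the last entry.\<close>
    ultimately have "n \<le> last ?xs"
      using mem unfolding ys by (auto simp: sorted_wrt_append)
    then have "{p. parking_function n p \<and> \<phi> p = ?\<pi>} =
        {p. (dyck_path n (map unlabel p) \<and> \<not> ends_NN (map unlabel p)) \<and> \<phi> p = ?\<pi>}"
      using \<pi> n \<open>?xs \<noteq> []\<close> consecutive_increasing_last_descent[of _ ?xs k]
      by (auto simp: parking_function_iff sorted_except_last_def)
    also have "card \<dots> = card {w. dyck_path n w \<and> \<not> ends_NN w}"
      by (rule card_labeled_paths) (simp add: len dyck_path_def)
    also have "{w. dyck_path n w \<and> \<not> ends_NN w} =
        {w. dyck_path n w} - {w. dyck_path n w \<and> ends_NN w}"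
      by auto
    also have "real (card \<dots>) =
        real (card {w. dyck_path n w}) - real (card {w. dyck_path n w \<and> ends_NN w})"
      using finite_dyck_paths[of n]
      by (subst card_Diff_subset) (auto intro!: of_nat_diff card_mono)
    finally have "real (card {p. parking_function n p \<and> \<phi> p = ?\<pi>}) =
        real (card {w. dyck_path n w}) - real (card {w. dyck_path n w \<and> ends_NN w})" .
    \<comment> \<open>From \<open>1 \<le> k\<close> and \<open>k < n\<close> it follows that
      \<open>n - 1 \<ge> 1\<close>, as the bijection requires.\<close>
    moreover have "card {w. dyck_path n w \<and> ends_NN w} = card {w. dyck_path (n - 1) w}"
      using card_dyck_paths_ends_NN[of "n - 1"] k n by simp
    ultimately show ?thesis
      using False by (simp add: card_dyck_paths)
  qed
qed

theorem theorem16: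
  fixes n :: nat
  assumes "n \<ge> 1"
  shows "real (pf n [[2,1,3], [3,1,2], [3,2,1]]) =
           catalan n + (real n - 1) * (catalan n - catalan (n - 1))
       \<and> catalan n + (real n - 1) * (catalan n - catalan (n - 1)) =
           real n * catalan n - (real n - 1) * catalan (n - 1)"
proof
  let ?F = "\<lambda>k. {p. parking_function n p \<and> \<phi> p = sorted_except_last n k}"
  have finite: "finite (?F k)" for k
    by (rule finite_subset[OF _ finite_parking_functions[of n]]) blast
  have "parking_function n p \<and> (\<forall>\<rho> \<in> set [[2,1,3], [3,1,2], [3,2,1]]. avoids (\<phi> p) \<rho>) \<longleftrightarrow>
      (\<exists>k \<in> {1..n}. p \<in> ?F k)" for p
    using avoids_iff_sorted_butlast[of "\<phi> p"] permutation_sorted_butlast_iff[OF assms, of "\<phi> p"]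
    unfolding parking_function_iff by blast
  then have "pf n [[2,1,3], [3,1,2], [3,2,1]] = card (\<Union>k \<in> {1..n}. ?F k)"
    unfolding pf_def by (intro arg_cong[of _ _ card]) blast
  \<comment> \<open>The fibres are disjoint, since \<open>k\<close> is the last entry of
    \<open>sorted_except_last n k\<close>.\<close>
  also have "\<dots> = (\<Sum>k \<in> {1..n}. card (?F k))"
    using finite by (intro card_UN_disjoint) (auto simp: sorted_except_last_def)
  finally have "real (pf n [[2,1,3], [3,1,2], [3,2,1]]) = (\<Sum>k \<in> {1..n}. real (card (?F k)))"
    by simp
  also have "\<dots> = (\<Sum>k \<in> {1..n}. if k = n then catalan n else catalan n - catalan (n - 1))"
    by (intro sum.cong refl card_parking_functions_fibre)
  \<comment> \<open>The identity, at \<open>k = n\<close>, is split off; the other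
    \<open>n - 1\<close> summands are equal.\<close>
  also have "\<dots> = catalan n + (\<Sum>k \<in> {1..n} - {n}. catalan n - catalan (n - 1))"
    using assms by (subst sum.remove[of _ n]) (auto intro!: sum.cong)
  also have "\<dots> = catalan n + (real n - 1) * (catalan n - catalan (n - 1))"
    using assms by (simp add: of_nat_diff)
  finally show "real (pf n [[2,1,3], [3,1,2], [3,2,1]]) =
      catalan n + (real n - 1) * (catalan n - catalan (n - 1))" .
qed (simp add: algebra_simps)

end
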